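(* Let $(\lambda,\nu)$ be real parameters satisfying either $\lambda>0$ and $\nu>0$, or $\nu=0$ and $\lambda\in(0,1)$. The distribution $\mathrm{CMP}(\lambda,\nu)$ is infinitely divisible if and only if $\nu=0$ or $\nu=1$.
   Context: For $(\lambda,\nu)$ with either $\lambda,\nu>0$, or $\nu=0$ and $\lambda\in(0,1)$, the Conway-Maxwell-Poisson distribution $\mathrm{CMP}(\lambda,\nu)$ is the law of a random variable $X$ with values in $\{0,1,2,\dots\}$ and probability mass function $$\mathbb{P}(X=k)=\frac{1}{Z(\lambda,\nu)}\cdot\frac{\lambda^k}{(k!)^{\nu}},\qquad k=0,1,2,\dots,$$ where $Z(\lambda,\nu)=\sum_{k=0}^\infty \lambda^k/(k!)^\nu$ is the normalising constant. Infinite divisibility has its usual meaning: for every integer $n\ge 1$, the distribution is the law of a sum of $n$ i.i.d. real random variables. *)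

theory Defs
  imports "HOL-Probability.Probability" "HOL-Real_Asymp.Real_Asymp"
begin

definition cmp_weight :: "real \<Rightarrow> real \<Rightarrow> nat \<Rightarrow> real" where
  "cmp_weight l \<nu> k = l ^ k / (fact k) powr \<nu>"

definition cmp_Z :: "real \<Rightarrow> real \<Rightarrow> real" where
  "cmp_Z l \<nu> = (\<Sum>k. cmp_weight l \<nu> k)"

text \<open>
  The value of \<open>embed_pmf\<close> is meaningful only if the given function is a probability mass
  function; for admissible parameters this is the content of \<open>pmf_cmp_pmf\<close> below.
\<close>
definition cmp_pmf :: "real \<Rightarrow> real \<Rightarrow> nat pmf" where
  "cmp_pmf l \<nu> = embed_pmf (\<lambda>k. 1 / cmp_Z l \<nu> * cmp_weight l \<nu> k)"

text \<open>Infinite divisibility concerns real random variables, so the law is moved to the real line.\<close>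
definition CMP :: "real \<Rightarrow> real \<Rightarrow> real measure" where
  "CMP l \<nu> = distr (measure_pmf (cmp_pmf l \<nu>)) borel real"

definition law_of_iid_sum :: "'s measure \<Rightarrow> (nat \<Rightarrow> 's \<Rightarrow> real) \<Rightarrow> nat \<Rightarrow> real measure \<Rightarrow> bool" where
  "law_of_iid_sum \<Omega> X n M \<longleftrightarrow>
     prob_space \<Omega> \<and>
     prob_space.indep_vars \<Omega> (\<lambda>_. borel) X {..<n} \<and>
     (\<forall>i<n. \<forall>j<n. distr \<Omega> borel (X i) = distr \<Omega> borel (X j)) \<and>
     distr \<Omega> borel (\<lambda>\<omega>. \<Sum>i<n. X i \<omega>) = M"

text \<open>
  One cannot quantify existentially over the type of the sample space, so it is fixed to be
  \<^typ>\<open>nat \<Rightarrow> real\<close>. This loses no generality, see \<open>law_of_iid_sum_transfer\<close> below.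
\<close>
definition infinitely_divisible :: "real measure \<Rightarrow> bool" where
  "infinitely_divisible M \<longleftrightarrow>
     (\<forall>n\<ge>1. \<exists>(\<Omega> :: (nat \<Rightarrow> real) measure) X. law_of_iid_sum \<Omega> X n M)"

lemma law_of_iid_sum_transfer:
  fixes \<Omega> :: "'s measure"
  assumes "law_of_iid_sum \<Omega> X n M"
  shows "\<exists>(\<Omega>' :: (nat \<Rightarrow> real) measure) X'. law_of_iid_sum \<Omega>' X' n M"
proof -
  interpret prob_space \<Omega>
    using assms unfolding law_of_iid_sum_def by blast
  have ind: "indep_vars (\<lambda>_. borel) X {..<n}"
    and id: "\<And>i j. i < n \<Longrightarrow> j < n \<Longrightarrow> distr \<Omega> borel (X i) = distr \<Omega> borel (X j)"
    and M: "distr \<Omega> borel (\<lambda>\<omega>. \<Sum>i<n. X i \<omega>) = M"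
    using assms unfolding law_of_iid_sum_def by blast+
  have rv: "X i \<in> borel_measurable \<Omega>" if "i < n" for i
    using ind that by (auto simp: indep_vars_def)
  define T where "T = (\<lambda>\<omega>. \<lambda>i\<in>{..<n}. X i \<omega>)"
  define P :: "(nat \<Rightarrow> real) measure" where "P = Pi\<^sub>M {..<n} (\<lambda>_. borel)"
  have T: "T \<in> measurable \<Omega> P"
    unfolding T_def P_def using rv by (intro measurable_restrict) auto
  define Q where "Q = distr \<Omega> P T"
  interpret Q: prob_space Q
    unfolding Q_def by (rule prob_space_distr[OF T])
  have comp: "(\<lambda>\<omega>. \<omega> i) \<in> borel_measurable P" if "i < n" for i
    unfolding P_def using that by (intro measurable_component_singleton) simp
  have compQ: "(\<lambda>\<omega>. \<omega> i) \<in> borel_measurable Q" if "i < n" for i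
    using comp[OF that] by (simp add: Q_def)
  have marg: "distr Q borel (\<lambda>\<omega>. \<omega> i) = distr \<Omega> borel (X i)" if "i < n" for i
  proof -
    have "distr Q borel (\<lambda>\<omega>. \<omega> i) = distr \<Omega> borel ((\<lambda>\<omega>. \<omega> i) \<circ> T)"
      unfolding Q_def by (rule distr_distr[OF comp[OF that] T])
    also have "(\<lambda>\<omega>. \<omega> i) \<circ> T = X i"
      using that by (auto simp: T_def)
    finally show ?thesis .
  qed
  have "Q.indep_vars (\<lambda>_. borel) (\<lambda>i \<omega>. \<omega> i) {..<n}"
  proof (cases "n = 0")
    case True
    then show ?thesis by (simp add: Q.indep_vars_def Q.indep_sets_def)
  next
    case False
    have "distr Q P (\<lambda>\<omega>. \<lambda>i\<in>{..<n}. \<omega> i) = distr \<Omega> P ((\<lambda>\<omega>. \<lambda>i\<in>{..<n}. \<omega> i) \<circ> T)"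
      unfolding Q_def
      by (rule distr_distr[OF _ T]) (unfold P_def, intro measurable_restrict measurable_component_singleton)
    also have "(\<lambda>\<omega>. \<lambda>i\<in>{..<n}. \<omega> i) \<circ> T = T"
      by (auto simp: T_def)
    also have "distr \<Omega> P T = Pi\<^sub>M {..<n} (\<lambda>i. distr \<Omega> borel (X i))"
      using ind False rv unfolding T_def P_def
      by (subst indep_vars_iff_distr_eq_PiM'[symmetric]) auto
    also have "\<dots> = Pi\<^sub>M {..<n} (\<lambda>i. distr Q borel (\<lambda>\<omega>. \<omega> i))"
      using marg by (intro PiM_cong) auto
    finally show ?thesis
      using False compQ unfolding P_def
      by (subst Q.indep_vars_iff_distr_eq_PiM') (auto simp: restrict_def)
  qed
  moreover have "distr Q borel (\<lambda>\<omega>. \<Sum>i<n. \<omega> i) = M"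
  proof -
    have "distr Q borel (\<lambda>\<omega>. \<Sum>i<n. \<omega> i) = distr \<Omega> borel ((\<lambda>\<omega>. \<Sum>i<n. \<omega> i) \<circ> T)"
      unfolding Q_def using comp by (intro distr_distr T borel_measurable_sum) auto
    also have "(\<lambda>\<omega>. \<Sum>i<n. \<omega> i) \<circ> T = (\<lambda>\<omega>. \<Sum>i<n. X i \<omega>)"
      by (auto simp: T_def)
    finally show ?thesis using M by simp
  qed
  moreover have "distr Q borel (\<lambda>\<omega>. \<omega> i) = distr Q borel (\<lambda>\<omega>. \<omega> j)" if "i < n" "j < n" for i j
    using id[OF that] by (simp only: marg[OF that(1)] marg[OF that(2)])
  ultimately have "law_of_iid_sum Q (\<lambda>i \<omega>. \<omega> i) n M"
    unfolding law_of_iid_sum_def using Q.prob_space_axioms by blast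
  then show ?thesis by blast
qed

lemma cmp_weight_pos: "l > 0 \<Longrightarrow> cmp_weight l \<nu> k > 0"
  by (simp add: cmp_weight_def)

lemma summable_cmp_weight:
  assumes "(l > 0 \<and> \<nu> > 0) \<or> (\<nu> = 0 \<and> 0 < l \<and> l < 1)"
  shows "summable (cmp_weight l \<nu>)"
proof (cases "\<nu> = 0")
  case True
  then have "cmp_weight l \<nu> = (\<lambda>k. l ^ k)"
    by (auto simp: cmp_weight_def)
  then show ?thesis
    using assms True by (auto intro: summable_geometric)
next
  case False
  with assms have l: "l > 0" and \<nu>: "\<nu> > 0"
    by auto
  have "filterlim (\<lambda>k. real (Suc k) powr \<nu>) at_top sequentially"
    using \<nu> by real_asymp
  then have "eventually (\<lambda>k. 2 * l \<le> real (Suc k) powr \<nu>) sequentially"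
    by (simp add: filterlim_at_top)
  then obtain N where N: "\<And>k. k \<ge> N \<Longrightarrow> 2 * l \<le> real (Suc k) powr \<nu>"
    by (auto simp: eventually_sequentially)
  show ?thesis
  proof (rule summable_ratio_test[of "1/2" N])
    fix k assume "k \<ge> N"
    have step: "cmp_weight l \<nu> (Suc k) = l / real (Suc k) powr \<nu> * cmp_weight l \<nu> k"
      by (simp add: cmp_weight_def powr_mult del: of_nat_Suc)
    have "l / real (Suc k) powr \<nu> \<le> 1 / 2"
      using N[OF \<open>k \<ge> N\<close>] l by (simp add: field_simps del: of_nat_Suc)
    then show "norm (cmp_weight l \<nu> (Suc k)) \<le> 1 / 2 * norm (cmp_weight l \<nu> k)"
      using cmp_weight_pos[OF l, of \<nu> k] cmp_weight_pos[OF l, of \<nu> "Suc k"]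
      unfolding step real_norm_def
      by (metis abs_of_pos less_imp_le mult_right_mono)
  qed simp
qed

lemma pmf_cmp_pmf:
  assumes "(l > 0 \<and> \<nu> > 0) \<or> (\<nu> = 0 \<and> 0 < l \<and> l < 1)"
  shows "pmf (cmp_pmf l \<nu>) k = 1 / cmp_Z l \<nu> * (l ^ k / (fact k) powr \<nu>)"
proof -
  have l: "l > 0"
    using assms by auto
  note S = summable_cmp_weight[OF assms]
  have Z: "cmp_Z l \<nu> > 0"
    unfolding cmp_Z_def using S cmp_weight_pos[OF l] by (intro suminf_pos) auto
  have nn: "0 \<le> 1 / cmp_Z l \<nu> * cmp_weight l \<nu> k" for k
    using Z cmp_weight_pos[OF l, of \<nu> k] by simp
  have "(\<lambda>k. 1 / cmp_Z l \<nu> * cmp_weight l \<nu> k) sums (1 / cmp_Z l \<nu> * cmp_Z l \<nu>)"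
    unfolding cmp_Z_def by (intro sums_mult summable_sums S)
  then have "(\<lambda>k. 1 / cmp_Z l \<nu> * cmp_weight l \<nu> k) sums 1"
    using Z by simp
  then have "(\<integral>\<^sup>+k. ennreal (1 / cmp_Z l \<nu> * cmp_weight l \<nu> k) \<partial>count_space UNIV) = 1"
    using nn suminf_ennreal_eq[OF nn] by (simp only: nn_integral_count_space_nat ennreal_1)
  then show ?thesis
    unfolding cmp_pmf_def using nn by (subst pmf_embed_pmf) (auto simp: cmp_weight_def)
qed

end

theory Submission
  imports Defs
begin

text \<open>
  If the law \<open>p\<close> is infinitely divisible with \<open>p\<^sub>0 > 0\<close>, its \<open>n\<close>-th convolution roots \<open>q\<^sub>n\<close> live on
  the natural numbers, and \<open>q\<^sub>n ^ n = p\<close> as power series. Differentiating,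
  \<open>(p' / p) * q\<^sub>n = n * q\<^sub>n'\<close> has nonnegative coefficients; since \<open>q\<^sub>n\<close> tends to 1 as \<open>n\<close> grows,
  so has \<open>p' / p\<close>. For the CMP weights this says, after scaling the coefficients of \<open>p' / p\<close>, that
  \<open>(k + 1) powr (1 - \<nu>) = (\<Sum>j\<le>k. c\<^sub>j * (k! / (k - j)!) powr \<nu>)\<close> with all \<open>c\<^sub>j \<ge> 0\<close> and \<open>c\<^sub>0 = 1\<close>.
  For \<open>\<nu> > 1\<close> this fails at \<open>k = 1\<close>. For \<open>0 < \<nu> < 1\<close>, letting \<open>k\<close> grow forces \<open>c\<^sub>j = 0\<close> whenever
  \<open>j \<nu> > 1 - \<nu>\<close>, and the leading order can only be matched if some \<open>m > 0\<close> satisfies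
  \<open>m \<nu> = 1 - \<nu>\<close> and \<open>c\<^sub>m \<ge> 1\<close>. Then the right-hand side is at least \<open>1 + (k - m) powr a\<close> with
  \<open>a = 1 - \<nu>\<close>, which contradicts \<open>(k + 1) powr a - (k - m) powr a \<rightarrow> 0\<close>.
  Conversely, \<open>\<nu> = 1\<close> is the Poisson and \<open>\<nu> = 0\<close> the geometric law, whose roots are Poisson and
  negative binomial laws.
\<close>

unbundle no vec_syntax
unbundle fps_syntax

section \<open>Growth of falling factorials and the exponent of the recursion\<close>

lemma fact_div_fact_le_power:
  assumes "j \<le> k"
  shows "fact k / fact (k - j) \<le> real k ^ j"
  using fact_div_fact_le_pow[OF assms] fact_dvd[of "k - j" k, where 'a=nat]
  by (metis (mono_tags, lifting) diff_le_self of_nat_fact of_nat_le_iff of_nat_power real_of_nat_div)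

text \<open>Each of the \<open>j\<close> factors \<open>k\<close>, \<open>k - 1\<close>, ...,
  \<open>k - j + 1\<close> of the quotient is at least \<open>k - j\<close>. The induction peels
  them off one by one with the base \<open>k - j\<close> held fixed.\<close>

lemma power_le_fact_div_fact:
  assumes "j \<le> k"
  shows "(real k - real j) ^ j \<le> fact k / fact (k - j)"
proof -
  have "(real k - real j) ^ i * fact (k - i) \<le> fact k" if "i \<le> j" for i
    using that
  proof (induction i)
    case (Suc i)
    have "fact (k - i) = real (k - i) * fact (k - Suc i)"
      using Suc.prems assms by (metis Suc_diff_Suc Suc_le_lessD fact_Suc less_le_trans)
    moreover have "real k - real j \<le> real (k - i)"
      using Suc.prems assms by auto
    ultimately have "(real k - real j) * fact (k - Suc i) \<le> fact (k - i)"
      by (simp add: mult_right_mono)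
    then have "(real k - real j) ^ i * ((real k - real j) * fact (k - Suc i)) \<le> (real k - real j) ^ i * fact (k - i)"
      using assms by (intro mult_left_mono) auto
    then show ?case using Suc by (simp add: mult_ac)
  qed simp
  from this[of j] show ?thesis
    by (simp add: field_simps)
qed

text \<open>The \<open>j\<close>-th summand grows like \<open>c j * k powr (j * \<nu>)\<close>, so
  comparing orders of growth in \<open>k\<close> restricts which \<open>c j\<close> can be nonzero;
  the constant summand at \<open>j = 0\<close> then gives the contradiction.\<close>

lemma cumulant_recursion_exponent:
  fixes \<nu> :: real and c :: "nat \<Rightarrow> real"
  assumes \<nu>: "\<nu> > 0"
    and c: "\<And>j. c j \<ge> 0"
    and rec: "\<And>k. real (k + 1) powr (1 - \<nu>) = (\<Sum>j\<le>k. c j * (fact k / fact (k - j)) powr \<nu>)"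
  shows "\<nu> = 1"
proof (rule ccontr)
  assume "\<nu> \<noteq> 1"
  have c0: "c 0 = 1"
    using rec[of 0] by simp
  define a where "a = 1 - \<nu>"
  have "\<nu> < 1"
  proof (rule ccontr)
    assume "\<not> \<nu> < 1"
    with \<open>\<nu> \<noteq> 1\<close> have "2 powr (1 - \<nu>) < (2::real) powr 0"
      by (intro powr_less_mono) auto
    moreover have "2 powr (1 - \<nu>) = c 0 + c 1"
      using rec[of 1] by simp
    ultimately show False using c0 c[of 1] by simp
  qed
  then have a: "0 < a" "a < 1"
    using \<nu> by (auto simp: a_def)
  have ff_upper: "(fact k / fact (k - j)) powr \<nu> \<le> real k powr (real j * \<nu>)" if "j \<le> k" "k > 0" for j k
    using powr_mono2[OF _ _ fact_div_fact_le_power[OF that(1)], of \<nu>] \<nu> that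
    by (simp add: powr_realpow[symmetric] powr_powr)
  have ff_lower: "(real k - real j) powr (real j * \<nu>) \<le> (fact k / fact (k - j)) powr \<nu>"
    if "j < k" for j k
    using powr_mono2[OF _ _ power_le_fact_div_fact[OF less_imp_le[OF that]], of \<nu>] \<nu> that
    by (simp add: powr_realpow[symmetric] powr_powr)
  \<comment> \<open>All summands are nonnegative, so each one alone is bounded by the left-hand side
    of order \<open>k powr a\<close>.\<close>
  have vanish: "c j = 0" if j: "a < real j * \<nu>" for j
  proof -
    define b where "b = real j * \<nu>"
    have "a < b" using j by (simp add: b_def)
    have "(\<lambda>k. (real k + 1) powr a / (real k - real j) powr b) \<longlonglongrightarrow> 0"
      using \<open>a < b\<close> by real_asymp
    moreover have "eventually (\<lambda>k. c j \<le> (real k + 1) powr a / (real k - real j) powr b) sequentially"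
      using eventually_gt_at_top[of j]
    proof eventually_elim
      case (elim k)
      have "c j * (real k - real j) powr b \<le> c j * (fact k / fact (k - j)) powr \<nu>"
        using ff_lower[OF elim] c by (auto simp: b_def intro: mult_left_mono)
      also have "\<dots> \<le> (\<Sum>j\<le>k. c j * (fact k / fact (k - j)) powr \<nu>)"
        using elim c by (intro member_le_sum[of j]) auto
      also have "\<dots> = (real k + 1) powr a"
        using rec[of k] by (simp add: a_def add_ac)
      finally show ?case
        using elim by (simp add: field_simps)
    qed
    ultimately have "c j \<le> 0"
      by (rule tendsto_lowerbound) simp
    with c[of j] show ?thesis by simp
  qed
  \<comment> \<open>This is the largest index with \<open>m * \<nu> \<le> a\<close>; beyond it every
    coefficient vanishes, so the sum has a fixed number of terms once
    \<open>k \<ge> m\<close>.\<close>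
  define m where "m = nat \<lfloor>a / \<nu>\<rfloor>"
  have m: "real m * \<nu> \<le> a" "a < real (Suc m) * \<nu>"
  proof -
    have "real m \<le> a / \<nu>" "a / \<nu> < real (Suc m)"
      using a \<nu> by (auto simp: m_def) linarith+
    then show "real m * \<nu> \<le> a" "a < real (Suc m) * \<nu>"
      using \<nu> by (auto simp: field_simps)
  qed
  have trunc: "(real k + 1) powr a = (\<Sum>j\<le>m. c j * (fact k / fact (k - j)) powr \<nu>)" if "k \<ge> m" for k
  proof -
    have "(\<Sum>j\<le>k. c j * (fact k / fact (k - j)) powr \<nu>) = (\<Sum>j\<le>m. c j * (fact k / fact (k - j)) powr \<nu>)"
    proof (rule sum.mono_neutral_right)
      show "\<forall>i\<in>{..k} - {..m}. c i * (fact k / fact (k - i)) powr \<nu> = 0"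
      proof
        fix i assume "i \<in> {..k} - {..m}"
        then have "real (Suc m) * \<nu> \<le> real i * \<nu>"
          using \<nu> by (intro mult_right_mono) auto
        then show "c i * (fact k / fact (k - i)) powr \<nu> = 0"
          using m(2) vanish[of i] by auto
      qed
    qed (use that in auto)
    then show ?thesis using rec[of k] by (simp add: a_def add_ac)
  qed
  have upper: "1 \<le> (\<Sum>j\<le>m. c j * real k powr (real j * \<nu> - a))" if "k \<ge> m" "k > 0" for k
  proof -
    have "real k powr a \<le> (real k + 1) powr a"
      using a by (intro powr_mono2) auto
    also have "\<dots> \<le> (\<Sum>j\<le>m. c j * real k powr (real j * \<nu>))"
      unfolding trunc[OF that(1)] using ff_upper c that by (intro sum_mono mult_left_mono) auto
    also have "\<dots> = real k powr a * (\<Sum>j\<le>m. c j * real k powr (real j * \<nu> - a))"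
      using that by (simp add: sum_distrib_left powr_diff)
    finally show ?thesis
      using that by simp
  qed
  \<comment> \<open>After division by \<open>k powr a\<close>, only an index with
    \<open>j * \<nu> = a\<close> survives in the limit. As that limit is at least 1, such an index
    exists, and it must be \<open>m\<close>.\<close>
  have tends: "(\<lambda>k. \<Sum>j\<le>m. c j * real k powr (real j * \<nu> - a)) \<longlonglongrightarrow> (\<Sum>j\<le>m. if real j * \<nu> = a then c j else 0)"
  proof (rule tendsto_sum)
    fix j assume "j \<in> {..m}"
    then have "real j * \<nu> \<le> real m * \<nu>"
      using \<nu> by (intro mult_right_mono) auto
    with m have "real j * \<nu> \<le> a" by simp
    show "(\<lambda>k. c j * real k powr (real j * \<nu> - a)) \<longlonglongrightarrow> (if real j * \<nu> = a then c j else 0)"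
    proof (cases "real j * \<nu> = a")
      case True
      have "(\<lambda>k. c j * real k powr 0) \<longlonglongrightarrow> c j" by real_asymp
      with True show ?thesis by simp
    next
      case False
      define e where "e = real j * \<nu> - a"
      have "e < 0" using False \<open>real j * \<nu> \<le> a\<close> by (simp add: e_def)
      then have "(\<lambda>k. real k powr e) \<longlonglongrightarrow> 0" by real_asymp
      from tendsto_mult_left[OF this, of "c j"] False show ?thesis by (simp add: e_def)
    qed
  qed
  have "eventually (\<lambda>k. 1 \<le> (\<Sum>j\<le>m. c j * real k powr (real j * \<nu> - a))) sequentially"
    using eventually_gt_at_top[of m] by eventually_elim (rule upper, auto)
  with tends have ge1: "1 \<le> (\<Sum>j\<le>m. if real j * \<nu> = a then c j else 0)"
    by (rule tendsto_lowerbound) simp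
  then have "(\<Sum>j\<le>m. if real j * \<nu> = a then c j else 0) \<noteq> 0"
    by linarith
  then obtain j where "j \<in> {..m}" "(if real j * \<nu> = a then c j else 0) \<noteq> 0"
    by (rule sum.not_neutral_contains_not_neutral)
  then have j: "j \<le> m" "real j * \<nu> = a"
    by (auto split: if_splits)
  have "j = m"
  proof -
    have "real m * \<nu> \<le> real j * \<nu>"
      using j m(1) by simp
    with \<nu> have "real m \<le> real j" by (simp only: mult_le_cancel_right_pos)
    with j show ?thesis by simp
  qed
  have ma: "real m * \<nu> = a" using j \<open>j = m\<close> by simp
  have "(\<Sum>j\<le>m. if real j * \<nu> = a then c j else 0) = (\<Sum>j\<le>m. if j = m then c j else 0)"
    using ma \<nu> by (intro sum.cong) auto
  with ge1 have cm: "c m \<ge> 1" by simp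
  have "m > 0" using ma a by (cases "m = 0") auto
  \<comment> \<open>Only the summands at \<open>0\<close> and \<open>m\<close> are kept; they are
    distinct because \<open>a > 0\<close>.\<close>
  have low: "1 \<le> (real k + 1) powr a - (real k - real m) powr a" if "k > m" for k
  proof -
    have "1 + (real k - real m) powr a \<le> c 0 + c m * (fact k / fact (k - m)) powr \<nu>"
      using c0 mult_mono[OF cm ff_lower[OF that]] c ma by auto
    also have "\<dots> = (\<Sum>j\<in>{0,m}. c j * (fact k / fact (k - j)) powr \<nu>)"
      using \<open>m > 0\<close> by simp
    also have "\<dots> \<le> (\<Sum>j\<le>m. c j * (fact k / fact (k - j)) powr \<nu>)"
      using c by (intro sum_mono2) auto
    also have "\<dots> = (real k + 1) powr a"
      using trunc[of k] that by simp
    finally show ?thesis by simp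
  qed
  \<comment> \<open>Since \<open>a < 1\<close>, the increment of \<open>x powr a\<close> over a step
    of the fixed length \<open>m + 1\<close> tends to 0.\<close>
  have "(\<lambda>k. (real k + 1) powr a - (real k - real m) powr a) \<longlonglongrightarrow> 0"
    using a by real_asymp
  moreover have "eventually (\<lambda>k. 1 \<le> (real k + 1) powr a - (real k - real m) powr a) sequentially"
    using eventually_gt_at_top[of m] by eventually_elim (rule low)
  ultimately have "(1::real) \<le> 0"
    by (rule tendsto_lowerbound) simp
  then show False by simp
qed

section \<open>Logarithmic derivatives of power series and the CMP weights\<close>

text \<open>This is the necessary half of the classical criterion for infinitely divisible laws on
  the naturals: a nonnegativity that holds for \<open>H * q n\<close> passes to \<open>H\<close> as
  \<open>q n\<close> tends to 1 coefficientwise.\<close>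

lemma fps_log_deriv_nonneg:
  fixes p :: "real fps" and q :: "nat \<Rightarrow> real fps"
  assumes p0: "p $ 0 > 0"
    and nonneg: "\<And>n k. n \<ge> 1 \<Longrightarrow> q n $ k \<ge> 0"
    and sum_le: "\<And>n N. n \<ge> 1 \<Longrightarrow> (\<Sum>k<N. q n $ k) \<le> 1"
    and pow: "\<And>n. n \<ge> 1 \<Longrightarrow> q n ^ n = p"
  shows "(fps_deriv p * inverse p) $ k \<ge> 0"
proof -
  define H where "H = fps_deriv p * inverse p"
  have Hq: "(H * q n) $ k \<ge> 0" if n: "n \<ge> 1" for n k
  proof -
    have "fps_deriv p * q n = of_nat n * fps_deriv (q n) * (q n ^ (n - 1) * q n)"
      unfolding pow[OF n, symmetric] by (simp add: fps_deriv_power' mult_ac)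
    also have "q n ^ (n - 1) * q n = p"
      using power_minus_mult[of n "q n"] n pow[OF n] by simp
    finally have "H * q n = of_nat n * fps_deriv (q n) * (p * inverse p)"
      by (simp add: H_def mult_ac)
    also have "p * inverse p = 1"
      using p0 by (simp add: inverse_mult_eq_1')
    finally have "(H * q n) $ k = real n * (real (k + 1) * q n $ (k + 1))"
      by (simp flip: fps_of_nat)
    with nonneg[OF n] show ?thesis by simp
  qed
  \<comment> \<open>Nonnegativity selects the real root, whatever the parity of
    \<open>n\<close>.\<close>
  have q0: "q n $ 0 = root n (p $ 0)" if n: "n \<ge> 1" for n
    using n nonneg[OF n, of 0] by (simp flip: pow[OF n] add: fps_nth_power_0 real_root_power_cancel)
  have lim0: "(\<lambda>n. q n $ 0) \<longlonglongrightarrow> 1"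
    by (rule Lim_transform_eventually[OF LIMSEQ_root_const[OF p0]])
      (use q0 in \<open>auto simp: eventually_sequentially intro!: exI[of _ 1]\<close>)
  \<comment> \<open>The constant coefficient already takes up mass tending to 1, out of a total of
    at most 1.\<close>
  have limpos: "(\<lambda>n. q n $ i) \<longlonglongrightarrow> 0" if "i > 0" for i
  proof (rule tendsto_sandwich[where f = "\<lambda>_. 0" and h = "\<lambda>n. 1 - q n $ 0"])
    show "(\<lambda>n. 1 - q n $ 0) \<longlonglongrightarrow> 0"
      using tendsto_diff[OF tendsto_const lim0, of 1] by simp
    show "eventually (\<lambda>n. q n $ i \<le> 1 - q n $ 0) sequentially"
      using eventually_ge_at_top[of 1]
    proof eventually_elim
      case (elim n)
      have "(\<Sum>k\<in>{0,i}. q n $ k) \<le> (\<Sum>k<Suc i. q n $ k)"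
        using nonneg[OF elim] by (intro sum_mono2) auto
      with sum_le[OF elim, of "Suc i"] that show ?case by simp
    qed
    show "eventually (\<lambda>n. 0 \<le> q n $ i) sequentially"
      using nonneg by (auto simp: eventually_sequentially)
  qed simp
  \<comment> \<open>A coefficient of a product is a finite sum, so the limit may be taken termwise;
    only \<open>j = k\<close> remains.\<close>
  have "(\<lambda>n. (H * q n) $ k) \<longlonglongrightarrow> (\<Sum>j=0..k. H $ j * (if k - j = 0 then 1 else 0))"
    unfolding fps_mult_nth
    by (intro tendsto_sum tendsto_mult tendsto_const) (use lim0 limpos in auto)
  also have "(\<Sum>j=0..k. H $ j * (if k - j = 0 then 1 else 0)) = (\<Sum>j=0..k. if j = k then H $ j else 0)"
    by (intro sum.cong) auto
  also have "\<dots> = H $ k"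
    by simp
  finally show ?thesis
    unfolding H_def[symmetric] by (rule tendsto_lowerbound) (use Hq in \<open>auto simp: eventually_sequentially\<close>)
qed

text \<open>Comparing coefficients in \<open>H * p = fps_deriv p\<close> and multiplying by
  \<open>fact k powr \<nu> / (C * l ^ (k + 1))\<close> removes \<open>C\<close> and
  \<open>l\<close>. The power of \<open>l\<close> is shifted by one because differentiation lowers
  the index.\<close>

lemma cmp_weight_infdiv_exponent:
  fixes l \<nu> C :: real and p :: "real fps"
  assumes l: "l > 0" and \<nu>: "\<nu> > 0" and C: "C > 0"
    and p: "p = Abs_fps (\<lambda>k. C * (l ^ k / fact k powr \<nu>))"
    and H: "\<And>k. (fps_deriv p * inverse p) $ k \<ge> 0"
  shows "\<nu> = 1"
proof -
  define H where "H = fps_deriv p * inverse p"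
  have "H * p = fps_deriv p * (inverse p * p)"
    by (simp add: H_def mult_ac)
  also have "inverse p * p = 1"
    using C by (simp add: inverse_mult_eq_1 p)
  finally have Hp: "H * p = fps_deriv p" by simp
  show ?thesis
  proof (rule cumulant_recursion_exponent[OF \<nu>])
    show "H $ j / l ^ (j + 1) \<ge> 0" for j
      using H l by (simp add: H_def)
    show "real (k + 1) powr (1 - \<nu>) = (\<Sum>j\<le>k. H $ j / l ^ (j + 1) * (fact k / fact (k - j)) powr \<nu>)" for k
    proof -
      have "(\<Sum>j\<le>k. H $ j / l ^ (j + 1) * (fact k / fact (k - j)) powr \<nu>)
          = (\<Sum>j\<le>k. H $ j * p $ (k - j) * (fact k powr \<nu> / (C * l ^ (k + 1))))"
      proof (intro sum.cong refl)
        fix j assume "j \<in> {..k}"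
        then have "l ^ (k + 1) = l ^ (j + 1) * l ^ (k - j)"
          by (simp flip: power_add)
        then show "H $ j / l ^ (j + 1) * (fact k / fact (k - j)) powr \<nu>
            = H $ j * p $ (k - j) * (fact k powr \<nu> / (C * l ^ (k + 1)))"
          using l C by (simp add: p powr_divide)
      qed
      also have "\<dots> = (H * p) $ k * (fact k powr \<nu> / (C * l ^ (k + 1)))"
        by (simp add: fps_mult_nth atLeast0AtMost sum_distrib_right sum_divide_distrib)
      also have "(H * p) $ k = real (k + 1) * p $ (k + 1)"
        by (simp add: Hp)
      also have "\<dots> * (fact k powr \<nu> / (C * l ^ (k + 1))) = real (k + 1) * (fact k powr \<nu> / fact (k + 1) powr \<nu>)"
        using l C by (simp add: p)
      also have "\<dots> = real (k + 1) powr (1 - \<nu>)"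
        by (simp add: powr_mult powr_diff)
      finally show ?thesis by simp
    qed
  qed
qed

section \<open>From i.i.d. sums to roots of generating functions\<close>

text \<open>Generating functions turn independent sums into products. The series record only masses
  at natural numbers, so the summands must be natural-valued almost surely for the convolution to be
  complete.\<close>

lemma (in prob_space) fps_prob_indep_sum:
  fixes X :: "nat \<Rightarrow> 'a \<Rightarrow> real"
  assumes "indep_vars (\<lambda>_. borel) X {..<n}"
    and "\<And>i. i < n \<Longrightarrow> AE \<omega> in M. X i \<omega> \<in> \<nat>"
  shows "Abs_fps (\<lambda>k. prob {\<omega> \<in> space M. (\<Sum>i<n. X i \<omega>) = real k})
       = (\<Prod>i<n. Abs_fps (\<lambda>k. prob {\<omega> \<in> space M. X i \<omega> = real k}))"
  using assms
proof (induction n)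
  case 0
  have "prob {\<omega> \<in> space M. 0 = real k} = (if k = 0 then 1 else 0)" for k
    by (simp add: prob_space)
  then show ?case by (simp add: fps_eq_iff)
next
  case (Suc n)
  define S where "S = (\<lambda>\<omega>. \<Sum>i<n. X i \<omega>)"
  have rv: "X i \<in> borel_measurable M" if "i < Suc n" for i
    using Suc.prems(1) that by (auto simp: indep_vars_def)
  have S_rv [measurable]: "S \<in> borel_measurable M" and Xn [measurable]: "X n \<in> borel_measurable M"
    using rv by (auto simp: S_def intro!: borel_measurable_sum)
  have ind: "indep_var borel (X n) borel S"
    unfolding S_def using Suc.prems(1) by (intro indep_vars_sum) (auto simp: lessThan_Suc)
  have AES: "AE \<omega> in M. S \<omega> \<in> \<nat>"
  proof -
    have "AE \<omega> in M. \<forall>i\<in>{..<n}. X i \<omega> \<in> \<nat>"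
      using Suc.prems(2) by (intro AE_finite_allI) auto
    moreover have "(\<Sum>i<m. f i) \<in> \<nat>" if "\<forall>i\<in>{..<m}. f i \<in> \<nat>" for m and f :: "nat \<Rightarrow> real"
      using that by (induction m) auto
    ultimately show ?thesis
      unfolding S_def by (auto elim: eventually_mono)
  qed
  have AEX: "AE \<omega> in M. X n \<omega> \<in> \<nat>"
    using Suc.prems(2) by simp
  have "prob {\<omega> \<in> space M. S \<omega> + X n \<omega> = real k}
      = (\<Sum>j=0..k. prob {\<omega> \<in> space M. S \<omega> = real j} * prob {\<omega> \<in> space M. X n \<omega> = real (k - j)})" for k
  proof -
    define A where "A = (\<lambda>j. {\<omega> \<in> space M. S \<omega> = real j \<and> X n \<omega> = real (k - j)})"
    \<comment> \<open>Off a null set both parts are natural numbers, so the event splits into the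
      disjoint events \<open>A j\<close> with \<open>j \<le> k\<close>.\<close>
    have "prob {\<omega> \<in> space M. S \<omega> + X n \<omega> = real k} = prob (\<Union>j\<in>{0..k}. A j)"
    proof (rule measure_eq_AE)
      show "AE \<omega> in M. (\<omega> \<in> {\<omega> \<in> space M. S \<omega> + X n \<omega> = real k}) = (\<omega> \<in> (\<Union>j\<in>{0..k}. A j))"
        using AES AEX
      proof eventually_elim
        case (elim \<omega>)
        then obtain a b where "S \<omega> = real a" "X n \<omega> = real b"
          by (metis Nats_cases)
        then show ?case
          by (auto simp: A_def simp flip: of_nat_add intro!: bexI[of _ a])
      qed
    qed (auto simp: A_def)
    also have "\<dots> = (\<Sum>j=0..k. prob (A j))"
      by (rule finite_measure_finite_Union) (auto simp: A_def disjoint_family_on_def)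
    also have "\<dots> = (\<Sum>j=0..k. prob {\<omega> \<in> space M. S \<omega> = real j} * prob {\<omega> \<in> space M. X n \<omega> = real (k - j)})"
    proof (intro sum.cong refl)
      fix j
      have "A j = (\<lambda>\<omega>. (X n \<omega>, S \<omega>)) -` ({real (k - j)} \<times> {real j}) \<inter> space M"
        by (auto simp: A_def)
      also have "prob \<dots> = prob (X n -` {real (k - j)} \<inter> space M) * prob (S -` {real j} \<inter> space M)"
        by (rule indep_varD[OF ind]) auto
      finally show "prob (A j) = prob {\<omega> \<in> space M. S \<omega> = real j} * prob {\<omega> \<in> space M. X n \<omega> = real (k - j)}"
        by (simp add: vimage_def Int_def conj_commute mult.commute)
    qed
    finally show ?thesis .
  qed
  then have "Abs_fps (\<lambda>k. prob {\<omega> \<in> space M. (\<Sum>i<Suc n. X i \<omega>) = real k})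
      = Abs_fps (\<lambda>k. prob {\<omega> \<in> space M. S \<omega> = real k}) * Abs_fps (\<lambda>k. prob {\<omega> \<in> space M. X n \<omega> = real k})"
    by (simp add: fps_eq_iff fps_mult_nth S_def)
  also have "Abs_fps (\<lambda>k. prob {\<omega> \<in> space M. S \<omega> = real k})
      = (\<Prod>i<n. Abs_fps (\<lambda>k. prob {\<omega> \<in> space M. X i \<omega> = real k}))"
    unfolding S_def using Suc.prems
    by (intro Suc.IH) (auto intro: indep_vars_subset)
  finally show ?case by simp
qed

text \<open>The summands are only known to be real-valued. Independence forces them to be
  nonnegative, then to have an atom at 0, and finally to be natural-valued almost surely; after that
  generating functions apply.\<close>

lemma iid_sum_fps_root:
  fixes p :: "nat pmf"
  assumes "law_of_iid_sum \<Omega> X n (distr (measure_pmf p) borel real)"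
    and n: "n \<ge> 1" and p0: "pmf p 0 > 0"
  obtains q :: "real fps" where
    "\<And>k. q $ k \<ge> 0" "\<And>N. (\<Sum>k<N. q $ k) \<le> 1" "q ^ n = Abs_fps (pmf p)"
proof -
  interpret prob_space \<Omega>
    using assms(1) unfolding law_of_iid_sum_def by blast
  define S where "S = (\<lambda>\<omega>. \<Sum>i<n. X i \<omega>)"
  have ind: "indep_vars (\<lambda>_. borel) X {..<n}"
    and id: "\<forall>i<n. \<forall>j<n. distr \<Omega> borel (X i) = distr \<Omega> borel (X j)"
    and S: "distr \<Omega> borel S = distr (measure_pmf p) borel real"
    using assms(1) unfolding law_of_iid_sum_def S_def by blast+
  have ne: "{..<n} \<noteq> {}"
    using n by (auto simp: lessThan_empty_iff)
  have rv [measurable]: "X i \<in> borel_measurable \<Omega>" if "i < n" for i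
    using ind that by (auto simp: indep_vars_def)
  have S_rv [measurable]: "S \<in> borel_measurable \<Omega>"
    using rv by (auto simp: S_def intro!: borel_measurable_sum)
  have probX: "prob (X i -` B \<inter> space \<Omega>) = prob (X 0 -` B \<inter> space \<Omega>)"
    if "i < n" "B \<in> sets borel" for i B
    using arg_cong[OF id[rule_format, OF that(1), of 0], of "\<lambda>M. measure M B"] rv that n
    by (simp add: measure_distr)
  have probS: "prob (S -` B \<inter> space \<Omega>) = measure_pmf.prob p (real -` B)"
    if "B \<in> sets borel" for B
    using arg_cong[OF S, of "\<lambda>M. measure M B"] that by (simp add: measure_distr)
  have joint: "prob (\<Inter>i\<in>{..<n}. X i -` B i \<inter> space \<Omega>) = (\<Prod>i<n. prob (X 0 -` B i \<inter> space \<Omega>))"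
    if "\<And>i. i < n \<Longrightarrow> B i \<in> sets borel" for B
  proof -
    have "prob (\<Inter>i\<in>{..<n}. X i -` B i \<inter> space \<Omega>) = (\<Prod>i<n. prob (X i -` B i \<inter> space \<Omega>))"
      by (rule indep_varsD[OF ind ne]) (auto simp: that)
    also have "\<dots> = (\<Prod>i<n. prob (X 0 -` B i \<inter> space \<Omega>))"
      by (intro prod.cong refl probX) (auto simp: that)
    finally show ?thesis .
  qed
  \<comment> \<open>If all \<open>n\<close> summands were negative together, the sum would be
    negative, an event of probability 0.\<close>
  have neg: "prob (X 0 -` {..<0} \<inter> space \<Omega>) = 0"
  proof -
    have "prob (X 0 -` {..<0} \<inter> space \<Omega>) ^ n = prob (\<Inter>i\<in>{..<n}. X i -` {..<0} \<inter> space \<Omega>)"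
      using joint[of "\<lambda>_. {..<0}"] by simp
    also have "\<dots> \<le> prob (S -` {..<0} \<inter> space \<Omega>)"
    proof (rule finite_measure_mono)
      show "(\<Inter>i\<in>{..<n}. X i -` {..<0} \<inter> space \<Omega>) \<subseteq> S -` {..<0} \<inter> space \<Omega>"
      proof
        fix \<omega> assume "\<omega> \<in> (\<Inter>i\<in>{..<n}. X i -` {..<0} \<inter> space \<Omega>)"
        then have "\<And>i. i < n \<Longrightarrow> X i \<omega> < 0" "\<omega> \<in> space \<Omega>"
          using ne by auto
        then show "\<omega> \<in> S -` {..<0} \<inter> space \<Omega>"
          using sum_strict_mono[OF _ ne, of "\<lambda>i. X i \<omega>" "\<lambda>_. 0"] by (simp add: S_def)
      qed
    qed (use measurable_sets[OF S_rv] in auto)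
    also have "\<dots> = 0"
      by (subst probS) (auto simp: vimage_def)
    finally have "prob (X 0 -` {..<0} \<inter> space \<Omega>) ^ n = 0"
      by (intro antisym) auto
    then show ?thesis by simp
  qed
  have nonneg: "AE \<omega> in \<Omega>. X i \<omega> \<ge> 0" if "i < n" for i
  proof -
    have "prob {\<omega> \<in> space \<Omega>. X i \<omega> < 0} = 0"
      using neg probX[OF that, of "{..<0}"] by (simp add: vimage_def Int_def conj_commute)
    then show ?thesis
      using that by (subst (asm) prob_eq_0) (auto simp: not_less)
  qed
  \<comment> \<open>A sum of nonnegative terms vanishes only if every term does.\<close>
  have zero: "prob (X 0 -` {0} \<inter> space \<Omega>) ^ n = pmf p 0"
  proof -
    have "AE \<omega> in \<Omega>. \<forall>i\<in>{..<n}. X i \<omega> \<ge> 0"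
      using nonneg by (intro AE_finite_allI) auto
    then have "AE \<omega> in \<Omega>. (\<omega> \<in> (\<Inter>i\<in>{..<n}. X i -` {0} \<inter> space \<Omega>)) = (\<omega> \<in> S -` {0} \<inter> space \<Omega>)"
    proof eventually_elim
      case (elim \<omega>)
      then have "S \<omega> = 0 \<longleftrightarrow> (\<forall>i\<in>{..<n}. X i \<omega> = 0)"
        unfolding S_def by (intro sum_nonneg_eq_0_iff) auto
      then show ?case
        using ne by auto
    qed
    then have "prob (\<Inter>i\<in>{..<n}. X i -` {0} \<inter> space \<Omega>) = prob (S -` {0} \<inter> space \<Omega>)"
      using ne by (intro measure_eq_AE) auto
    moreover have "real -` {0} = {0}"
      by auto
    ultimately show ?thesis
      using joint[of "\<lambda>_. {0}"] by (simp add: probS pmf.rep_eq)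
  qed
  have nat: "AE \<omega> in \<Omega>. X i \<omega> \<in> \<nat>" if i: "i < n" for i
  proof -
    have Nats: "(\<nat> :: real set) \<in> sets borel"
      unfolding Nats_def by (rule sets.countable) auto
    \<comment> \<open>These sets describe one non-natural summand at \<open>i\<close> while all
      others are 0, which would make the sum non-natural.\<close>
    define B :: "nat \<Rightarrow> real set" where "B = (\<lambda>j. if j = i then - \<nat> else {0})"
    have B: "B j \<in> sets borel" for j
      using borel_comp[OF Nats] by (cases "j = i") (simp_all add: B_def)
    have "(\<Prod>j<n. prob (X 0 -` B j \<inter> space \<Omega>)) = prob (\<Inter>j\<in>{..<n}. X j -` B j \<inter> space \<Omega>)"
      by (rule joint[of B, symmetric]) (rule B)
    also have "\<dots> \<le> prob (S -` (- \<nat>) \<inter> space \<Omega>)"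
    proof (rule finite_measure_mono)
      show "(\<Inter>j\<in>{..<n}. X j -` B j \<inter> space \<Omega>) \<subseteq> S -` (- \<nat>) \<inter> space \<Omega>"
      proof
        fix \<omega> assume "\<omega> \<in> (\<Inter>j\<in>{..<n}. X j -` B j \<inter> space \<Omega>)"
        then have \<omega>: "\<And>j. j < n \<Longrightarrow> X j \<omega> \<in> B j" and "\<omega> \<in> space \<Omega>"
          using ne by auto
        have "X j \<omega> = (if j = i then X i \<omega> else 0)" if "j < n" for j
          using \<omega>[OF that] by (cases "j = i") (simp_all add: B_def)
        then have "S \<omega> = (\<Sum>j<n. if j = i then X i \<omega> else 0)"
          unfolding S_def by (intro sum.cong) simp_all
        also have "\<dots> = X i \<omega>"
          using i by simp
        finally show "\<omega> \<in> S -` (- \<nat>) \<inter> space \<Omega>"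
          using \<omega>[OF i] \<open>\<omega> \<in> space \<Omega>\<close> by (simp add: B_def)
      qed
    qed (use measurable_sets[OF S_rv] Nats in auto)
    also have "\<dots> = 0"
      using Nats by (subst probS) (auto simp: vimage_def)
    finally have "(\<Prod>j<n. prob (X 0 -` B j \<inter> space \<Omega>)) = 0"
      by (intro antisym prod_nonneg) auto
    \<comment> \<open>The atom at 0 has positive mass, so the vanishing factor can only be the one
      at \<open>i\<close>.\<close>
    then obtain j where "j < n" "prob (X 0 -` B j \<inter> space \<Omega>) = 0"
      by auto
    moreover have "prob (X 0 -` {0} \<inter> space \<Omega>) \<noteq> 0"
      using zero p0 n by (auto simp: zero_power)
    ultimately have "prob (X 0 -` (- \<nat>) \<inter> space \<Omega>) = 0"
      by (auto simp: B_def split: if_splits)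
    then have "prob {\<omega> \<in> space \<Omega>. X i \<omega> \<notin> \<nat>} = 0"
      using probX[OF i, of "- \<nat>"] Nats by (simp add: vimage_def Int_def conj_commute)
    then show ?thesis
      using measurable_sets[OF rv[OF i] borel_comp[OF Nats]]
      by (subst (asm) prob_eq_0) (simp_all add: vimage_def Int_def conj_commute)
  qed
  define q where "q = Abs_fps (\<lambda>k. prob {\<omega> \<in> space \<Omega>. X 0 \<omega> = real k})"
  show ?thesis
  proof (rule that[of q])
    show "q $ k \<ge> 0" for k
      by (simp add: q_def)
    show "(\<Sum>k<N. q $ k) \<le> 1" for N
    proof -
      have "(\<Sum>k<N. q $ k) = prob (\<Union>k<N. {\<omega> \<in> space \<Omega>. X 0 \<omega> = real k})"
        unfolding q_def fps_nth_Abs_fps using n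
        by (intro finite_measure_finite_Union[symmetric]) (auto simp: disjoint_family_on_def)
      then show ?thesis by simp
    qed
    have "Abs_fps (pmf p) = Abs_fps (\<lambda>k. prob {\<omega> \<in> space \<Omega>. S \<omega> = real k})"
    proof (rule fps_ext)
      fix k
      have "real -` {real k} = {k}" by auto
      then show "Abs_fps (pmf p) $ k = Abs_fps (\<lambda>k. prob {\<omega> \<in> space \<Omega>. S \<omega> = real k}) $ k"
        using probS[of "{real k}"] by (simp add: pmf.rep_eq vimage_def Int_def conj_commute)
    qed
    also have "\<dots> = (\<Prod>i<n. Abs_fps (\<lambda>k. prob {\<omega> \<in> space \<Omega>. X i \<omega> = real k}))"
      unfolding S_def by (rule fps_prob_indep_sum[OF ind nat])
    also have "\<dots> = (\<Prod>i<n. q)"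
    proof (intro prod.cong refl fps_ext)
      fix i k assume "i \<in> {..<n}"
      then show "Abs_fps (\<lambda>k. prob {\<omega> \<in> space \<Omega>. X i \<omega> = real k}) $ k = q $ k"
        using probX[of i "{real k}"] by (simp add: q_def vimage_def Int_def conj_commute)
    qed
    finally show "q ^ n = Abs_fps (pmf p)" by simp
  qed
qed

section \<open>Building the convolution roots of the Poisson and geometric laws\<close>

text \<open>The coordinates under a product of \<open>n\<close> copies of \<open>q\<close> are
  i.i.d., and the generating function of their sum is the \<open>n\<close>-th power.\<close>

lemma iid_sum_of_fps_root:
  fixes p q :: "nat pmf"
  assumes "Abs_fps (pmf q) ^ n = Abs_fps (pmf p)"
  shows "\<exists>(\<Omega> :: (nat \<Rightarrow> real) measure) X. law_of_iid_sum \<Omega> X n (distr (measure_pmf p) borel real)"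
proof -
  define P where "P = Pi_pmf {..<n} 0 (\<lambda>_. q)"
  define X :: "nat \<Rightarrow> (nat \<Rightarrow> nat) \<Rightarrow> real" where "X = (\<lambda>i \<omega>. real (\<omega> i))"
  have ind: "prob_space.indep_vars P (\<lambda>_. borel) X {..<n}"
    unfolding X_def P_def
    by (rule prob_space.indep_vars_compose2[OF measure_pmf.prob_space_axioms indep_vars_Pi_pmf]) auto
  have comp: "map_pmf (\<lambda>\<omega>. \<omega> i) P = q" if "i < n" for i
    using that by (simp add: P_def Pi_pmf_component)
  have marg: "measure_pmf.prob P {\<omega>. X i \<omega> = real k} = pmf q k" if "i < n" for i k
    by (subst comp[OF that, symmetric]) (simp add: X_def pmf_map vimage_def)
  have "Abs_fps (\<lambda>k. measure_pmf.prob P {\<omega>. (\<Sum>i<n. X i \<omega>) = real k})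
      = (\<Prod>i<n. Abs_fps (\<lambda>k. measure_pmf.prob P {\<omega>. X i \<omega> = real k}))"
    using prob_space.fps_prob_indep_sum[OF measure_pmf.prob_space_axioms ind] by (simp add: X_def)
  also have "\<dots> = (\<Prod>i<n. Abs_fps (pmf q))"
    by (intro prod.cong refl fps_ext) (simp add: marg)
  also have "\<dots> = Abs_fps (pmf p)"
    using assms by simp
  finally have *: "measure_pmf.prob P {\<omega>. (\<Sum>i<n. X i \<omega>) = real k} = pmf p k" for k
    by (simp add: fps_eq_iff)
  have sum: "map_pmf (\<lambda>\<omega>. \<Sum>i<n. \<omega> i) P = p"
  proof (rule pmf_eqI)
    fix k
    have "pmf (map_pmf (\<lambda>\<omega>. \<Sum>i<n. \<omega> i) P) k = measure_pmf.prob P {\<omega>. (\<Sum>i<n. X i \<omega>) = real k}"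
      by (simp add: pmf_map vimage_def X_def flip: of_nat_sum)
    with * show "pmf (map_pmf (\<lambda>\<omega>. \<Sum>i<n. \<omega> i) P) k = pmf p k" by simp
  qed
  have distr_real: "distr (measure_pmf (map_pmf f P)) borel real = distr (measure_pmf P) borel (\<lambda>\<omega>. real (f \<omega>))" for f
    by (simp add: map_pmf_rep_eq distr_distr comp_def)
  have "law_of_iid_sum (measure_pmf P) X n (distr (measure_pmf p) borel real)"
    unfolding law_of_iid_sum_def
  proof (intro conjI allI impI)
    show "distr (measure_pmf P) borel (X i) = distr (measure_pmf P) borel (X j)" if "i < n" "j < n" for i j
      using distr_real[of "\<lambda>\<omega>. \<omega> i"] distr_real[of "\<lambda>\<omega>. \<omega> j"] comp[OF that(1)] comp[OF that(2)]
      by (simp add: X_def)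
    show "distr (measure_pmf P) borel (\<lambda>\<omega>. \<Sum>i<n. X i \<omega>) = distr (measure_pmf p) borel real"
      using distr_real[of "\<lambda>\<omega>. \<Sum>i<n. \<omega> i"] by (simp add: sum X_def)
  qed (fact measure_pmf.prob_space_axioms ind)+
  \<comment> \<open>The sample space built here consists of functions from naturals to naturals and
    is carried over to the required type.\<close>
  then show ?thesis
    by (rule law_of_iid_sum_transfer)
qed

text \<open>The root is the negative binomial law of shape \<open>1 / n\<close>, with generating
  function \<open>((1 - l) / (1 - l * z)) powr (1 / n)\<close>.\<close>

lemma geometric_fps_root:
  fixes l :: real
  assumes l: "0 < l" "l < 1" and n: "n \<ge> 1"
  obtains q :: "nat pmf" where "Abs_fps (pmf q) ^ n = Abs_fps (\<lambda>k. (1 - l) * l ^ k)"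
proof -
  define r where "r = 1 / real n"
  define f where "f = (\<lambda>k. (1 - l) powr r * (((- r) gchoose k) * (- l) ^ k))"
  have nonneg: "f k \<ge> 0" for k
  proof -
    \<comment> \<open>The signs of the generalised binomial coefficient and of
      \<open>(- l) ^ k\<close> cancel.\<close>
    have "((- r) gchoose k) * (- l) ^ k = pochhammer r k / fact k * l ^ k"
      by (simp add: gbinomial_pochhammer power_minus[of l] mult_ac)
    moreover have "pochhammer r k \<ge> 0"
      by (intro pochhammer_nonneg) (use n in \<open>simp add: r_def\<close>)
    ultimately show ?thesis
      using l by (simp add: f_def)
  qed
  have "f sums ((1 - l) powr r * (1 + - l) powr (- r))"
    unfolding f_def using l by (intro sums_mult gen_binomial_real) auto
  also have "(1 - l) powr r * (1 + - l) powr (- r) = 1"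
    using l by (simp flip: powr_add)
  finally have "(\<integral>\<^sup>+k. ennreal (f k) \<partial>count_space UNIV) = 1"
    using suminf_ennreal_eq[OF nonneg] by (simp only: nn_integral_count_space_nat ennreal_1)
  then have "pmf (embed_pmf f) k = f k" for k
    using nonneg by (subst pmf_embed_pmf) auto
  then have pmf_f: "pmf (embed_pmf f) = f" ..
  \<comment> \<open>\<open>fps_binomial (- r)\<close> is the series of
    \<open>(1 + z) powr (- r)\<close>; substituting \<open>- l * z\<close> gives the generating
    function, and the \<open>n\<close>-th power turns the exponent into \<open>- 1\<close>, a
    geometric series.\<close>
  have "Abs_fps f ^ n = (fps_const ((1 - l) powr r) * (fps_binomial (- r) oo (fps_const (- l) * fps_X))) ^ n"
    by (intro arg_cong[where f = "\<lambda>x. x ^ n"] fps_ext) (simp add: f_def mult.commute[of "(- l) ^ k" for k])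
  also have "\<dots> = fps_const (((1 - l) powr r) ^ n) * (fps_binomial (- r) ^ n oo (fps_const (- l) * fps_X))"
    by (simp add: power_mult_distrib fps_compose_power)
  also have "((1 - l) powr r) ^ n = 1 - l"
    using l n by (simp add: r_def powr_realpow[symmetric] powr_powr)
  also have "fps_binomial (- r) ^ n = fps_binomial (- 1)"
    using n by (simp add: fps_binomial_power r_def)
  also have "fps_const (1 - l) * (fps_binomial (- 1) oo (fps_const (- l) * fps_X)) = Abs_fps (\<lambda>k. (1 - l) * l ^ k)"
    by (rule fps_ext) (simp add: gbinomial_pochhammer power_minus[of l] flip: pochhammer_fact)
  finally have "Abs_fps (pmf (embed_pmf f)) ^ n = Abs_fps (\<lambda>k. (1 - l) * l ^ k)"
    by (simp add: pmf_f)
  then show ?thesis by (rule that)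
qed

text \<open>The generating function \<open>exp (l * (z - 1))\<close> is the \<open>n\<close>-th
  power of the one with parameter \<open>l / n\<close>.\<close>

lemma poisson_fps_root:
  assumes l: "l > 0" and n: "n \<ge> 1"
  shows "Abs_fps (pmf (poisson_pmf (l / n))) ^ n = Abs_fps (pmf (poisson_pmf l))"
proof -
  have eq: "Abs_fps (pmf (poisson_pmf m)) = fps_const (exp (- m)) * fps_exp m" if "m > 0" for m
    using that by (simp add: fps_eq_iff)
  show ?thesis
    using l n by (simp add: eq power_mult_distrib fps_exp_power_mult flip: exp_of_nat_mult)
qed

section \<open>The characterisation of infinite divisibility\<close>

theorem theorem1:
  fixes l \<nu> :: real
  assumes "(l > 0 \<and> \<nu> > 0) \<or> (\<nu> = 0 \<and> 0 < l \<and> l < 1)"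
  shows "infinitely_divisible (CMP l \<nu>) \<longleftrightarrow> \<nu> = 0 \<or> \<nu> = 1"
proof
  have l: "l > 0"
    using assms by auto
  have pmf: "pmf (cmp_pmf l \<nu>) k = 1 / cmp_Z l \<nu> * (l ^ k / fact k powr \<nu>)" for k
    by (rule pmf_cmp_pmf[OF assms])
  have Z: "cmp_Z l \<nu> > 0"
    unfolding cmp_Z_def using summable_cmp_weight[OF assms] cmp_weight_pos[OF l] by (intro suminf_pos) auto
  show "\<nu> = 0 \<or> \<nu> = 1" if "infinitely_divisible (CMP l \<nu>)"
  proof (cases "\<nu> = 0")
    case False
    have p0: "pmf (cmp_pmf l \<nu>) 0 > 0"
      using Z by (simp add: pmf)
    have "\<exists>q :: real fps. (\<forall>k. q $ k \<ge> 0) \<and> (\<forall>N. (\<Sum>k<N. q $ k) \<le> 1) \<and> q ^ n = Abs_fps (pmf (cmp_pmf l \<nu>))"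
      if n: "n \<ge> 1" for n
    proof -
      from \<open>infinitely_divisible (CMP l \<nu>)\<close> n obtain \<Omega> :: "(nat \<Rightarrow> real) measure" and X
        where "law_of_iid_sum \<Omega> X n (CMP l \<nu>)"
        unfolding infinitely_divisible_def by blast
      then show ?thesis
        unfolding CMP_def by (rule iid_sum_fps_root[OF _ n p0]) blast
    qed
    \<comment> \<open>One root is chosen for every \<open>n\<close> at once, since the sign argument
      lets \<open>n\<close> tend to infinity.\<close>
    then obtain q :: "nat \<Rightarrow> real fps" where
      "\<And>n k. n \<ge> 1 \<Longrightarrow> q n $ k \<ge> 0" "\<And>n N. n \<ge> 1 \<Longrightarrow> (\<Sum>k<N. q n $ k) \<le> 1"
      "\<And>n. n \<ge> 1 \<Longrightarrow> q n ^ n = Abs_fps (pmf (cmp_pmf l \<nu>))"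
      by metis
    then have "(fps_deriv (Abs_fps (pmf (cmp_pmf l \<nu>))) * inverse (Abs_fps (pmf (cmp_pmf l \<nu>)))) $ k \<ge> 0" for k
      using p0 by (intro fps_log_deriv_nonneg[where q = q]) auto
    then have "\<nu> = 1"
      using assms False l Z
      by (intro cmp_weight_infdiv_exponent[of l \<nu> "1 / cmp_Z l \<nu>" "Abs_fps (pmf (cmp_pmf l \<nu>))"])
        (auto simp: pmf fps_eq_iff)
    then show ?thesis ..
  qed simp
  show "infinitely_divisible (CMP l \<nu>)" if "\<nu> = 0 \<or> \<nu> = 1"
    unfolding infinitely_divisible_def CMP_def
  proof (intro allI impI)
    fix n :: nat assume n: "n \<ge> 1"
    have "\<exists>q :: nat pmf. Abs_fps (pmf q) ^ n = Abs_fps (pmf (cmp_pmf l \<nu>))"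
      using that
    proof
      assume "\<nu> = 0"
      with assms have l1: "l < 1" by auto
      then have "cmp_Z l 0 = 1 / (1 - l)"
        using l by (simp add: cmp_Z_def cmp_weight_def suminf_geometric)
      then have "pmf (cmp_pmf l \<nu>) = (\<lambda>k. (1 - l) * l ^ k)"
        using \<open>\<nu> = 0\<close> by (intro ext) (simp add: pmf[unfolded \<open>\<nu> = 0\<close>])
      with l l1 n show ?thesis
        by (metis geometric_fps_root)
    next
      assume "\<nu> = 1"
      \<comment> \<open>The normalising constant is the exponential series, which identifies the law
        as Poisson.\<close>
      have "cmp_Z l 1 = exp l"
        by (simp add: cmp_Z_def cmp_weight_def exp_def divide_inverse mult.commute)
      then have "cmp_pmf l \<nu> = poisson_pmf l"
        using l \<open>\<nu> = 1\<close> by (intro pmf_eqI) (simp add: pmf[unfolded \<open>\<nu> = 1\<close>] exp_minus field_simps)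
      with poisson_fps_root[OF l n] show ?thesis by metis
    qed
    then show "\<exists>(\<Omega> :: (nat \<Rightarrow> real) measure) X. law_of_iid_sum \<Omega> X n (distr (measure_pmf (cmp_pmf l \<nu>)) borel real)"
      using iid_sum_of_fps_root by blast
  qed
qed

end
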